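(* Let $G$ be a finite simple connected graph with $m>0$ edges and minimum degree $\delta$. Then $$\frac{\delta\sqrt{2}\,m^2}{M_1(G)} \le DSO(G) \le m\sqrt{\frac{M_1(G)-m}{M_1(G)}}.$$ Equality in the lower bound holds if and only if $G$ is regular. Equality in the upper bound holds if and only if $G\cong K_2$.
   Context: For a finite simple graph $G=(V(G),E(G))$, $d_u$ denotes the degree of the vertex $u$. The Diminished Sombor index is $DSO(G)=\sum_{uv\in E(G)}\frac{\sqrt{d_u^2+d_v^2}}{d_u+d_v}$. The first Zagreb index is $M_1(G)=\sum_{v\in V(G)} d_v^2=\sum_{uv\in E(G)}(d_u+d_v)$. $K_2$ is the complete graph on two vertices. *)

theory Defs
  imports Complex_Main "Graph_Theory.Graph_Theory"
begin

text \<open>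
  A finite simple graph is represented, as in the locale \<^locale>\<open>graph\<close>, by a finite
  symmetric digraph without loops and parallel arcs. Each undirected edge \<open>uv\<close> therefore
  corresponds to the two arcs \<open>(u, v)\<close> and \<open>(v, u)\<close>, and the degree of a vertex \<open>v\<close> is
  \<^term>\<open>out_degree G v\<close>.
\<close>

definition uedges :: "('a, 'b) pre_digraph \<Rightarrow> 'a set set" where
  "uedges G = {{u, v} | u v. u \<rightarrow>\<^bsub>G\<^esub> v}"

definition min_degree :: "('a, 'b) pre_digraph \<Rightarrow> nat" where
  "min_degree G = Min (out_degree G ` verts G)"

definition regular_graph :: "('a, 'b) pre_digraph \<Rightarrow> bool" where
  "regular_graph G \<longleftrightarrow> (\<exists>k. \<forall>v \<in> verts G. out_degree G v = k)"

definition first_Zagreb :: "('a, 'b) pre_digraph \<Rightarrow> nat" where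
  "first_Zagreb G = (\<Sum>v \<in> verts G. (out_degree G v)\<^sup>2)"

text \<open>
  The inner sums range over the two endpoints of the edge; see \<open>sum_uedge\<close> below.
\<close>

definition DSO :: "('a, 'b) pre_digraph \<Rightarrow> real" where
  "DSO G = (\<Sum>e \<in> uedges G.
     sqrt (\<Sum>v \<in> e. (real (out_degree G v))\<^sup>2) / (\<Sum>v \<in> e. real (out_degree G v)))"

definition K2 :: "(nat, nat \<times> nat) pre_digraph" where
  "K2 = \<lparr> verts = {0, 1}, arcs = {(0, 1), (1, 0)}, tail = fst, head = snd \<rparr>"

lemma sum_uedge:
  assumes "Digraph.graph G" and "u \<rightarrow>\<^bsub>G\<^esub> v"
  shows "(\<Sum>w \<in> {u, v}. f w) = f u + (f v :: real)"
proof -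
  interpret Digraph.graph G by fact
  have "u \<noteq> v" using assms(2) adj_not_same by blast
  then show ?thesis by simp
qed

lemma complete_digraph_K2: "complete_digraph 2 K2"
proof -
  have "Digraph.graph K2"
    by unfold_locales (auto simp: K2_def arc_to_ends_def symmetric_conv)
  then show ?thesis
    by (auto simp: complete_digraph_def K2_def arcs_ends_conv)
qed

end

theory Submission
  imports Defs "HOL-Analysis.Convex"
begin

text \<open>
  Write \<open>d\<close> for the degree, \<open>S = d\<^sub>u + d\<^sub>v\<close> for the weight of an edge \<open>uv\<close>, and \<open>M = M\<^sub>1(G)\<close>.
  Each vertex \<open>v\<close> lies on \<open>d\<^sub>v\<close> edges, so the weights of all edges add up to \<open>M\<close>
  (\<open>sum_uedges_out_degree\<close>), and Cauchy-Schwarz gives \<open>m\<^sup>2 / M \<le> (\<Sum> 1 / S)\<close>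
  (\<open>card_power2_div_sum_le\<close>). Both bounds come from this one inequality, after
  an estimate of the individual edge terms.

  For the lower bound, both endpoints have degree at least \<open>\<delta>\<close>, so an edge contributes at least
  \<open>\<delta> * sqrt 2 / S\<close>, with equality exactly when both degrees are \<open>\<delta>\<close>. Summation gives the
  bound. If it is attained, every endpoint of an edge has degree \<open>\<delta>\<close>; as there is an edge,
  \<open>\<delta>\<close> is positive, so every vertex is an endpoint of an edge and the graph is regular.

  For the upper bound, \<open>2 * d\<^sub>u * d\<^sub>v \<ge> d\<^sub>u + d\<^sub>v\<close> holds for positive integers, which says that
  the square of an edge term is at most \<open>1 - 1 / S\<close>, with equality exactly for
  \<open>d\<^sub>u = d\<^sub>v = 1\<close>. A second use of Cauchy-Schwarz gives
  \<open>DSO\<^sup>2 \<le> m * (\<Sum> (1 - 1 / S)) \<le> m * (m - m\<^sup>2 / M)\<close>, the square of the claimed bound. If it is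
  attained, all endpoints of edges have degree 1, and a connected graph with this property and
  at least one edge is a single edge (\<open>digraph_iso_K2_iff\<close>).
\<close>

section \<open>Inequalities for real numbers\<close>

text \<open>
  The inequality between the arithmetic and the harmonic mean: Cauchy-Schwarz for the families
  \<open>sqrt x\<^sub>i\<close> and \<open>1 / sqrt x\<^sub>i\<close>, whose products are all 1.
\<close>
lemma card_power2_div_sum_le:
  fixes x :: "'i \<Rightarrow> real"
  assumes pos: "\<And>i. i \<in> I \<Longrightarrow> 0 < x i"
  shows "(real (card I))\<^sup>2 / sum x I \<le> (\<Sum>i\<in>I. 1 / x i)"
proof -
  have "real (card I) = (\<Sum>i\<in>I. sqrt (x i) * (1 / sqrt (x i)))"
    using pos by (simp add: less_imp_neq[symmetric])
  then have "(real (card I))\<^sup>2 \<le> (\<Sum>i\<in>I. (sqrt (x i))\<^sup>2) * (\<Sum>i\<in>I. (1 / sqrt (x i))\<^sup>2)"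
    using Cauchy_Schwarz_ineq_sum[of "\<lambda>i. sqrt (x i)" "\<lambda>i. 1 / sqrt (x i)" I] by simp
  also have "\<dots> = sum x I * (\<Sum>i\<in>I. 1 / x i)"
    using pos by (simp add: power_divide less_imp_le)
  finally have "(real (card I))\<^sup>2 \<le> (\<Sum>i\<in>I. 1 / x i) * sum x I"
    by (simp only: mult.commute)
  moreover have "0 \<le> sum x I" "0 \<le> (\<Sum>i\<in>I. 1 / x i)"
    using pos by (simp_all add: sum_nonneg less_imp_le)
  ultimately show ?thesis
    by (cases "sum x I = 0") (simp_all add: pos_divide_le_eq)
qed

lemma sqrt_sum_squares_ge_min:
  fixes d x y :: real
  assumes "0 \<le> d" "d \<le> x" "d \<le> y"
  shows "d * sqrt 2 \<le> sqrt (x\<^sup>2 + y\<^sup>2)"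
    and "sqrt (x\<^sup>2 + y\<^sup>2) = d * sqrt 2 \<longleftrightarrow> x = d \<and> y = d"
proof -
  have sq: "d\<^sup>2 \<le> x\<^sup>2" "d\<^sup>2 \<le> y\<^sup>2"
    using assms by (auto intro: power_mono)
  have eq: "d * sqrt 2 = sqrt (d\<^sup>2 + d\<^sup>2)"
    using assms(1) by (simp add: real_sqrt_mult flip: mult_2)
  show "d * sqrt 2 \<le> sqrt (x\<^sup>2 + y\<^sup>2)"
    unfolding eq using sq by simp
  have "x\<^sup>2 + y\<^sup>2 = d\<^sup>2 + d\<^sup>2 \<longleftrightarrow> x\<^sup>2 = d\<^sup>2 \<and> y\<^sup>2 = d\<^sup>2"
    using sq by linarith
  then show "sqrt (x\<^sup>2 + y\<^sup>2) = d * sqrt 2 \<longleftrightarrow> x = d \<and> y = d"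
    unfolding eq using assms by (simp add: power2_eq_iff_nonneg)
qed

text \<open>
  After clearing denominators both claims are about
  \<open>2 * x * y - (x + y) = x * (y - 1) + y * (x - 1)\<close>, a sum of two nonnegative terms.
\<close>
lemma diminished_term_power2_le:
  fixes x y :: real
  assumes "1 \<le> x" "1 \<le> y"
  shows "(sqrt (x\<^sup>2 + y\<^sup>2) / (x + y))\<^sup>2 \<le> 1 - 1 / (x + y)"
    and "(sqrt (x\<^sup>2 + y\<^sup>2) / (x + y))\<^sup>2 = 1 - 1 / (x + y) \<longleftrightarrow> x = 1 \<and> y = 1"
proof -
  have gap: "1 - 1 / (x + y) - (sqrt (x\<^sup>2 + y\<^sup>2) / (x + y))\<^sup>2
      = (x * (y - 1) + y * (x - 1)) / (x + y)\<^sup>2"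
    using assms by (simp add: power_divide divide_simps) (simp add: algebra_simps power2_eq_square)
  have nonneg: "0 \<le> x * (y - 1)" "0 \<le> y * (x - 1)"
    using assms by auto
  then have "0 \<le> (x * (y - 1) + y * (x - 1)) / (x + y)\<^sup>2"
    by simp
  then show "(sqrt (x\<^sup>2 + y\<^sup>2) / (x + y))\<^sup>2 \<le> 1 - 1 / (x + y)"
    using gap by linarith
  have "(sqrt (x\<^sup>2 + y\<^sup>2) / (x + y))\<^sup>2 = 1 - 1 / (x + y)
      \<longleftrightarrow> (x * (y - 1) + y * (x - 1)) / (x + y)\<^sup>2 = 0"
    using gap by linarith
  also have "\<dots> \<longleftrightarrow> x * (y - 1) + y * (x - 1) = 0"
    using assms by simp
  also have "\<dots> \<longleftrightarrow> x = 1 \<and> y = 1"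
    using assms nonneg by (simp add: add_nonneg_eq_0_iff) auto
  finally show "(sqrt (x\<^sup>2 + y\<^sup>2) / (x + y))\<^sup>2 = 1 - 1 / (x + y) \<longleftrightarrow> x = 1 \<and> y = 1" .
qed

section \<open>Edges and degrees\<close>

context graph
begin

lemma finite_uedges: "finite (uedges G)"
proof -
  have "uedges G = (\<lambda>(u, v). {u, v}) ` arcs_ends G"
    by (auto simp: uedges_def)
  then show ?thesis
    by (simp add: arcs_ends_conv)
qed

lemma out_degree_pos_iff: "0 < out_degree G u \<longleftrightarrow> (\<exists>v. u \<rightarrow>\<^bsub>G\<^esub> v)"
proof -
  have "0 < out_degree G u \<longleftrightarrow> out_arcs G u \<noteq> {}"
    by (simp add: out_degree_def card_gt_0_iff finite_out_arcs)
  also have "\<dots> \<longleftrightarrow> (\<exists>a\<in>arcs G. tail G a = u)"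
    by auto
  also have "\<dots> \<longleftrightarrow> (\<exists>v. u \<rightarrow>\<^bsub>G\<^esub> v)"
    unfolding arcs_ends_conv by blast
  finally show ?thesis .
qed

lemma uedgesE:
  assumes "e \<in> uedges G"
  obtains u v where "e = {u, v}" "u \<noteq> v" "u \<rightarrow>\<^bsub>G\<^esub> v" "v \<rightarrow>\<^bsub>G\<^esub> u"
  using assms adj_not_same arcs_ends_symmetric[OF sym_arcs] unfolding uedges_def by blast

lemma uedges_subset_verts: "e \<in> uedges G \<Longrightarrow> e \<subseteq> verts G"
  by (elim uedgesE) (auto dest: adj_in_verts)

lemma uedges_out_degree_ge_1: "\<lbrakk>e \<in> uedges G; v \<in> e\<rbrakk> \<Longrightarrow> 1 \<le> out_degree G v"
  by (elim uedgesE) (auto simp: Suc_le_eq out_degree_pos_iff)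

lemma uedges_degree_sum_pos:
  assumes "e \<in> uedges G"
  shows "0 < (\<Sum>v\<in>e. real (out_degree G v))"
  using assms
proof (rule uedgesE)
  fix u v assume "e = {u, v}"
  then show ?thesis
    using assms uedges_out_degree_ge_1[of e] by (intro sum_pos) (fastforce simp: Suc_le_eq)+
qed

text \<open>
  The arcs leaving \<open>v\<close> correspond to the edges at \<open>v\<close>: parallel arcs are excluded, and an edge
  determines the end of the arc other than \<open>v\<close>.
\<close>
lemma card_incident_uedges: "card {e \<in> uedges G. v \<in> e} = out_degree G v"
proof -
  have "bij_betw (\<lambda>a. {tail G a, head G a}) (out_arcs G v) {e \<in> uedges G. v \<in> e}"
  proof (rule bij_betw_imageI)
    show "inj_on (\<lambda>a. {tail G a, head G a}) (out_arcs G v)"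
      by (rule inj_onI) (auto simp: arc_to_ends_def doubleton_eq_iff intro: no_multi_arcs)
    show "(\<lambda>a. {tail G a, head G a}) ` out_arcs G v = {e \<in> uedges G. v \<in> e}"
    proof (intro equalityI subsetI)
      fix e assume "e \<in> {e \<in> uedges G. v \<in> e}"
      then obtain w where "e = {v, w}" "v \<rightarrow>\<^bsub>G\<^esub> w"
        by (auto elim!: uedgesE)
      then show "e \<in> (\<lambda>a. {tail G a, head G a}) ` out_arcs G v"
        by (auto elim!: reachableE)
    next
      fix e assume "e \<in> (\<lambda>a. {tail G a, head G a}) ` out_arcs G v"
      then show "e \<in> {e \<in> uedges G. v \<in> e}"
        unfolding uedges_def using in_arcs_imp_in_arcs_ends by fastforce
    qed
  qed
  then show ?thesis
    by (simp add: bij_betw_same_card out_degree_def)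
qed

text \<open>Double counting of the pairs of an edge and one of its endpoints, weighted by the degree.\<close>
lemma sum_uedges_out_degree:
  "(\<Sum>e\<in>uedges G. \<Sum>v\<in>e. real (out_degree G v)) = real (first_Zagreb G)"
proof -
  have "(\<Sum>e\<in>uedges G. \<Sum>v\<in>e. real (out_degree G v))
      = (\<Sum>e\<in>uedges G. \<Sum>v\<in>{v \<in> verts G. v \<in> e}. real (out_degree G v))"
    using uedges_subset_verts by (intro sum.cong) auto
  also have "\<dots> = (\<Sum>v\<in>verts G. \<Sum>e\<in>{e \<in> uedges G. v \<in> e}. real (out_degree G v))"
    by (rule sum.swap_restrict) (auto simp: finite_uedges)
  also have "\<dots> = real (first_Zagreb G)"
    by (simp add: card_incident_uedges first_Zagreb_def power2_eq_square)
  finally show ?thesis .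
qed

lemma uedges_power2_div_Zagreb_le:
  "(real (card (uedges G)))\<^sup>2 / real (first_Zagreb G)
    \<le> (\<Sum>e\<in>uedges G. 1 / (\<Sum>v\<in>e. real (out_degree G v)))"
  using card_power2_div_sum_le[of "uedges G" "\<lambda>e. \<Sum>v\<in>e. real (out_degree G v)"]
    uedges_degree_sum_pos
  by (simp only: sum_uedges_out_degree)

lemma first_Zagreb_pos:
  assumes "0 < card (uedges G)"
  shows "0 < real (first_Zagreb G)"
  unfolding sum_uedges_out_degree[symmetric]
proof (rule sum_pos)
  show "finite (uedges G)" "uedges G \<noteq> {}"
    using assms by (auto simp: card_gt_0_iff)
qed (rule uedges_degree_sum_pos)

text \<open>
  These values show that the bounds are attained: the lower one by regular graphs, with \<open>k = \<delta>\<close>,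
  the upper one when every edge has endpoints of degree \<open>k = 1\<close>.
\<close>
lemma constant_degree_values:
  assumes "0 < k" and "\<And>e v. \<lbrakk>e \<in> uedges G; v \<in> e\<rbrakk> \<Longrightarrow> out_degree G v = k"
  shows "DSO G = real (card (uedges G)) * (sqrt 2 / 2)"
    and "real (first_Zagreb G) = 2 * real k * real (card (uedges G))"
proof -
  have deg: "(\<Sum>v\<in>e. real (out_degree G v)) = 2 * real k"
    and sq: "(\<Sum>v\<in>e. (real (out_degree G v))\<^sup>2) = (real k)\<^sup>2 * 2" if "e \<in> uedges G" for e
    using that assms(2)[OF that] by (auto elim!: uedgesE)
  show "DSO G = real (card (uedges G)) * (sqrt 2 / 2)"
    unfolding DSO_def using assms(1) by (simp add: deg sq real_sqrt_mult)
  show "real (first_Zagreb G) = 2 * real k * real (card (uedges G))"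
    unfolding sum_uedges_out_degree[symmetric] by (simp add: deg)
qed

section \<open>The lower bound\<close>

lemma min_degree_le: "v \<in> verts G \<Longrightarrow> min_degree G \<le> out_degree G v"
  unfolding min_degree_def by simp

lemma uedge_term_ge_min_degree:
  assumes e: "e \<in> uedges G"
  shows "real (min_degree G) * sqrt 2 * (1 / (\<Sum>v\<in>e. real (out_degree G v)))
      \<le> sqrt (\<Sum>v\<in>e. (real (out_degree G v))\<^sup>2) / (\<Sum>v\<in>e. real (out_degree G v))"
    and "\<lbrakk>real (min_degree G) * sqrt 2 * (1 / (\<Sum>v\<in>e. real (out_degree G v)))
        = sqrt (\<Sum>v\<in>e. (real (out_degree G v))\<^sup>2) / (\<Sum>v\<in>e. real (out_degree G v)); v \<in> e\<rbrakk>
      \<Longrightarrow> out_degree G v = min_degree G"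
proof -
  let ?d = "real (min_degree G)" and ?D = "\<Sum>v\<in>e. real (out_degree G v)"
    and ?Q = "sqrt (\<Sum>v\<in>e. (real (out_degree G v))\<^sup>2)"
  obtain x y where xy: "e = {x, y}" "x \<noteq> y"
    using e by (rule uedgesE)
  have ge: "?d \<le> real (out_degree G x)" "?d \<le> real (out_degree G y)"
    using uedges_subset_verts[OF e] min_degree_le xy by auto
  have pos: "0 < ?D"
    using e by (rule uedges_degree_sum_pos)
  show "?d * sqrt 2 * (1 / ?D) \<le> ?Q / ?D"
    using sqrt_sum_squares_ge_min(1)[OF _ ge] xy pos by (simp add: divide_right_mono)
  assume "?d * sqrt 2 * (1 / ?D) = ?Q / ?D" "v \<in> e"
  then show "out_degree G v = min_degree G"
    using sqrt_sum_squares_ge_min(2)[OF _ ge] xy pos by auto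
qed

text \<open>
  The sum of \<open>\<delta> * sqrt 2 / S\<close> over all edges lies between the bound and the index. If these two
  agree, it equals the index, and then the termwise estimate is an equation at each edge.
\<close>
lemma DSO_lower_bound:
  assumes "0 < card (uedges G)"
  shows "real (min_degree G) * sqrt 2 * (real (card (uedges G)))\<^sup>2 / real (first_Zagreb G) \<le> DSO G"
    and "DSO G = real (min_degree G) * sqrt 2 * (real (card (uedges G)))\<^sup>2 / real (first_Zagreb G)
      \<longleftrightarrow> regular_graph G"
proof -
  let ?L = "real (min_degree G) * sqrt 2 * (real (card (uedges G)))\<^sup>2 / real (first_Zagreb G)"
  let ?D = "\<lambda>e. \<Sum>v\<in>e. real (out_degree G v)"
  let ?c = "real (min_degree G) * sqrt 2"
  have "?c * ((real (card (uedges G)))\<^sup>2 / real (first_Zagreb G)) \<le> ?c * (\<Sum>e\<in>uedges G. 1 / ?D e)"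
    by (rule mult_left_mono[OF uedges_power2_div_Zagreb_le]) simp
  then have L: "?L \<le> (\<Sum>e\<in>uedges G. ?c * (1 / ?D e))"
    by (simp add: sum_distrib_left)
  have R: "(\<Sum>e\<in>uedges G. ?c * (1 / ?D e)) \<le> DSO G"
    unfolding DSO_def by (rule sum_mono) (rule uedge_term_ge_min_degree(1))
  from L R show "?L \<le> DSO G"
    by linarith
  obtain e u where e: "e \<in> uedges G" "u \<in> e"
    using assms uedgesE by (metis card_gt_0_iff ex_in_conv insertI1)
  show "DSO G = ?L \<longleftrightarrow> regular_graph G"
  proof
    assume "DSO G = ?L"
    with L R have "(\<Sum>e\<in>uedges G. ?c * (1 / ?D e)) = DSO G"
      by linarith
    then have "?c * (1 / ?D e) = sqrt (\<Sum>v\<in>e. (real (out_degree G v))\<^sup>2) / ?D e"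
      if "e \<in> uedges G" for e
      unfolding DSO_def
      by (rule sum_mono_inv[OF _ uedge_term_ge_min_degree(1) that finite_uedges])
    then have min: "out_degree G v = min_degree G" if "e \<in> uedges G" "v \<in> e" for e v
      using that by (intro uedge_term_ge_min_degree(2))
    have "0 < min_degree G"
      using min[OF e] uedges_out_degree_ge_1[OF e] by simp
    have "out_degree G v = min_degree G" if "v \<in> verts G" for v
    proof -
      obtain w where "v \<rightarrow>\<^bsub>G\<^esub> w"
        using \<open>0 < min_degree G\<close> min_degree_le[OF \<open>v \<in> verts G\<close>] out_degree_pos_iff[of v]
        by auto
      then show ?thesis
        by (intro min[of "{v, w}"]) (auto simp: uedges_def)
    qed
    then show "regular_graph G"
      by (auto simp: regular_graph_def)
  next
    assume "regular_graph G"
    then obtain k where k: "\<And>v. v \<in> verts G \<Longrightarrow> out_degree G v = k"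
      by (auto simp: regular_graph_def)
    have u: "u \<in> verts G"
      using e uedges_subset_verts by auto
    have "0 < k"
      using k[OF u] uedges_out_degree_ge_1[OF e] by simp
    have "out_degree G ` verts G = {k}"
      using k u by auto
    then have "min_degree G = k"
      by (simp add: min_degree_def)
    moreover have "out_degree G v = k" if "e \<in> uedges G" "v \<in> e" for e v
      using k uedges_subset_verts that by auto
    ultimately show "DSO G = ?L"
      using constant_degree_values[OF \<open>0 < k\<close>] \<open>0 < k\<close> assms
      by (simp add: power2_eq_square field_simps)
  qed
qed

section \<open>The upper bound\<close>

lemma uedge_term_power2_le:
  assumes e: "e \<in> uedges G"
  shows "(sqrt (\<Sum>v\<in>e. (real (out_degree G v))\<^sup>2) / (\<Sum>v\<in>e. real (out_degree G v)))\<^sup>2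
      \<le> 1 - 1 / (\<Sum>v\<in>e. real (out_degree G v))"
    and "\<lbrakk>(sqrt (\<Sum>v\<in>e. (real (out_degree G v))\<^sup>2) / (\<Sum>v\<in>e. real (out_degree G v)))\<^sup>2
        = 1 - 1 / (\<Sum>v\<in>e. real (out_degree G v)); v \<in> e\<rbrakk> \<Longrightarrow> out_degree G v = 1"
proof -
  let ?T = "(sqrt (\<Sum>v\<in>e. (real (out_degree G v))\<^sup>2) / (\<Sum>v\<in>e. real (out_degree G v)))\<^sup>2"
    and ?R = "1 - 1 / (\<Sum>v\<in>e. real (out_degree G v))"
  obtain x y where xy: "e = {x, y}" "x \<noteq> y"
    using e by (rule uedgesE)
  have ge: "1 \<le> real (out_degree G x)" "1 \<le> real (out_degree G y)"
    using uedges_out_degree_ge_1[OF e] xy by auto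
  show "?T \<le> ?R"
    using diminished_term_power2_le(1)[OF ge] xy by simp
  assume "?T = ?R" "v \<in> e"
  then show "out_degree G v = 1"
    using diminished_term_power2_le(2)[OF ge] xy by auto
qed

text \<open>
  The argument runs on squares, because the edge terms are only controlled through their squares,
  which are bounded by a linear expression in \<open>1 / S\<close>. Equality in the bound makes the termwise
  estimate an equation at each edge, as for the lower bound.
\<close>
lemma DSO_upper_bound:
  assumes "0 < card (uedges G)"
  shows "DSO G \<le> real (card (uedges G))
      * sqrt ((real (first_Zagreb G) - real (card (uedges G))) / real (first_Zagreb G))"
    and "DSO G = real (card (uedges G))
      * sqrt ((real (first_Zagreb G) - real (card (uedges G))) / real (first_Zagreb G))
      \<longleftrightarrow> (\<forall>e\<in>uedges G. \<forall>v\<in>e. out_degree G v = 1)"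
proof -
  let ?m = "real (card (uedges G))" and ?M = "real (first_Zagreb G)"
  let ?U = "?m * sqrt ((?M - ?m) / ?M)"
  let ?D = "\<lambda>e. \<Sum>v\<in>e. real (out_degree G v)"
  let ?t = "\<lambda>e. sqrt (\<Sum>v\<in>e. (real (out_degree G v))\<^sup>2) / ?D e"
  have M: "0 < ?M"
    using assms by (rule first_Zagreb_pos)
  \<comment> \<open>The radicand is nonnegative because every edge has a positive integer as its weight.\<close>
  have "1 \<le> ?D e" if "e \<in> uedges G" for e
    using that uedges_degree_sum_pos[OF that] by (simp flip: of_nat_sum)
  then have "?m \<le> ?M"
    unfolding sum_uedges_out_degree[symmetric]
    using sum_mono[of "uedges G" "\<lambda>_. 1" ?D] by simp
  then have U2: "?U\<^sup>2 = ?m * (?m - ?m\<^sup>2 / ?M)" and U: "0 \<le> ?U"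
    using M by (auto simp: power_mult_distrib field_simps power2_eq_square)
  have A: "(DSO G)\<^sup>2 \<le> ?m * (\<Sum>e\<in>uedges G. (?t e)\<^sup>2)"
    unfolding DSO_def using sum_squared_le_sum_of_squares[of ?t "uedges G"]
    by (simp add: mult.commute)
  have B: "(\<Sum>e\<in>uedges G. (?t e)\<^sup>2) \<le> (\<Sum>e\<in>uedges G. 1 - 1 / ?D e)"
    by (rule sum_mono) (rule uedge_term_power2_le(1))
  have C: "(\<Sum>e\<in>uedges G. 1 - 1 / ?D e) \<le> ?m - ?m\<^sup>2 / ?M"
    using uedges_power2_div_Zagreb_le by (simp add: sum_subtractf)
  have "?m * (\<Sum>e\<in>uedges G. (?t e)\<^sup>2) \<le> ?U\<^sup>2"
    unfolding U2 using B C by (intro mult_left_mono) auto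
  with A have "(DSO G)\<^sup>2 \<le> ?U\<^sup>2"
    by linarith
  then show "DSO G \<le> ?U"
    using U by (rule power2_le_imp_le)
  show "DSO G = ?U \<longleftrightarrow> (\<forall>e\<in>uedges G. \<forall>v\<in>e. out_degree G v = 1)"
  proof
    assume "DSO G = ?U"
    with A have "?m * (?m - ?m\<^sup>2 / ?M) \<le> ?m * (\<Sum>e\<in>uedges G. (?t e)\<^sup>2)"
      using U2 by simp
    then have "?m - ?m\<^sup>2 / ?M \<le> (\<Sum>e\<in>uedges G. (?t e)\<^sup>2)"
      using assms by simp
    with B C have "(\<Sum>e\<in>uedges G. (?t e)\<^sup>2) = (\<Sum>e\<in>uedges G. 1 - 1 / ?D e)"
      by linarith
    then have "(?t e)\<^sup>2 = 1 - 1 / ?D e" if "e \<in> uedges G" for e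
      by (rule sum_mono_inv[OF _ uedge_term_power2_le(1) that finite_uedges])
    then show "\<forall>e\<in>uedges G. \<forall>v\<in>e. out_degree G v = 1"
      by (intro ballI) (rule uedge_term_power2_le(2))
  next
    assume "\<forall>e\<in>uedges G. \<forall>v\<in>e. out_degree G v = 1"
    then have "DSO G = ?m * (sqrt 2 / 2)" "?M = 2 * ?m"
      using constant_degree_values[of 1] by auto
    moreover have "sqrt ((2 * ?m - ?m) / (2 * ?m)) = sqrt 2 / 2"
    proof (rule real_sqrt_unique)
      show "(sqrt 2 / 2)\<^sup>2 = (2 * ?m - ?m) / (2 * ?m)"
        using assms by (simp add: power_divide)
    qed simp
    ultimately show "DSO G = ?U"
      by (simp only:)
  qed
qed

section \<open>Graphs in which all endpoints have degree one\<close>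

lemma out_degree_1_unique:
  assumes "out_degree G u = 1" "u \<rightarrow>\<^bsub>G\<^esub> v" "u \<rightarrow>\<^bsub>G\<^esub> w"
  shows "v = w"
proof -
  obtain a where "out_arcs G u = {a}"
    using assms(1) by (auto simp: out_degree_def card_1_singleton_iff)
  moreover obtain b c where "b \<in> out_arcs G u" "head G b = v" "c \<in> out_arcs G u" "head G c = w"
    using assms(2,3) by (auto elim!: reachableE)
  ultimately show ?thesis
    by auto
qed

text \<open>
  When the ends of an edge \<open>uv\<close> have degree 1, no walk from \<open>u\<close> leaves \<open>{u, v}\<close>, so connectedness
  leaves no other vertices. The isomorphism names the arcs of \<open>G\<close> by their ends, as \<open>K2\<close> does.
\<close>
lemma digraph_iso_K2_iff:
  assumes conn: "Digraph_Component.connected G" and "0 < card (uedges G)"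
  shows "digraph_iso G K2 \<longleftrightarrow> (\<forall>e\<in>uedges G. \<forall>v\<in>e. out_degree G v = 1)"
proof
  assume "digraph_iso G K2"
  then obtain f where f: "digraph_isomorphism f" "K2 = app_iso f G"
    by (auto simp: digraph_iso_def)
  have K2: "out_degree K2 i = 1" if "i \<in> verts K2" for i
  proof -
    have "out_arcs K2 i = {(i, 1 - i)}"
      using that by (auto simp: out_arcs_def K2_def)
    then show ?thesis
      by (simp add: out_degree_def)
  qed
  have "out_degree G v = 1" if "v \<in> verts G" for v
    using out_degree_app_iso_eq[OF f(1) that] K2[of "iso_verts f v"] that
    unfolding f(2) by simp
  then show "\<forall>e\<in>uedges G. \<forall>v\<in>e. out_degree G v = 1"
    using uedges_subset_verts by blast
next
  assume one: "\<forall>e\<in>uedges G. \<forall>v\<in>e. out_degree G v = 1"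
  obtain e where "e \<in> uedges G"
    using assms(2) by (auto simp: card_gt_0_iff)
  then obtain u v where uv: "e = {u, v}" "u \<noteq> v" "u \<rightarrow>\<^bsub>G\<^esub> v" "v \<rightarrow>\<^bsub>G\<^esub> u"
    by (rule uedgesE)
  have deg: "out_degree G u = 1" "out_degree G v = 1"
    using one \<open>e \<in> uedges G\<close> uv(1) by auto
  have "w \<in> {u, v}" if "u \<rightarrow>\<^sup>*\<^bsub>G\<^esub> w" for w
    using that
  proof (induction rule: reachable_induct)
    case (step x y)
    then show ?case
      using out_degree_1_unique[OF deg(1) uv(3)] out_degree_1_unique[OF deg(2) uv(4)] by auto
  qed simp
  moreover have "u \<rightarrow>\<^sup>*\<^bsub>G\<^esub> w" if "w \<in> verts G" for w
    using conn that adj_in_verts(1)[OF uv(3)] reachable_mk_symmetric_eq[OF sym_arcs]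
    by (auto simp: Digraph_Component.connected_def strongly_connected_def)
  ultimately have verts: "verts G = {u, v}"
    using adj_in_verts[OF uv(3)] by auto
  have ends: "arcs_ends G = {(u, v), (v, u)}"
  proof
    show "arcs_ends G \<subseteq> {(u, v), (v, u)}"
    proof (rule subrelI)
      fix x y assume xy: "x \<rightarrow>\<^bsub>G\<^esub> y"
      then have "x \<in> {u, v}" "y \<in> {u, v}" "x \<noteq> y"
        using adj_in_verts[OF xy] adj_not_same by (auto simp: verts)
      then show "(x, y) \<in> {(u, v), (v, u)}"
        by auto
    qed
  qed (use uv in simp)
  define f where "f w = (if w = u then 0 else 1 :: nat)" for w
  define h where "h = \<lparr>iso_verts = f, iso_arcs = \<lambda>a. (f (tail G a), f (head G a)),
    iso_head = snd, iso_tail = fst\<rparr>"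
  have inj: "inj_on f (verts G)"
    using uv(2) by (auto simp: inj_on_def f_def verts)
  have "inj_on (\<lambda>a. (f (tail G a), f (head G a))) (arcs G)"
  proof (rule inj_onI)
    fix a b assume "a \<in> arcs G" "b \<in> arcs G"
      "(f (tail G a), f (head G a)) = (f (tail G b), f (head G b))"
    then show "a = b"
      using inj by (intro no_multi_arcs) (auto simp: arc_to_ends_def inj_on_eq_iff)
  qed
  then have "digraph_isomorphism h"
    using inj wf_digraph by (simp add: digraph_isomorphism_def h_def)
  moreover have "(\<lambda>a. (f (tail G a), f (head G a))) ` arcs G = {(0, 1), (1, 0)}"
  proof -
    have "(\<lambda>a. (f (tail G a), f (head G a))) ` arcs G = map_prod f f ` arcs_ends G"
      by (simp add: arcs_ends_conv image_image)
    then show ?thesis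
      using uv(2) by (simp add: ends f_def)
  qed
  then have "K2 = app_iso h G"
    using uv(2) by (auto simp: K2_def app_iso_def h_def verts f_def)
  ultimately show "digraph_iso G K2"
    by (auto simp: digraph_iso_def)
qed

end

section \<open>Bounds for the Diminished Sombor index\<close>

theorem theorem5:
  fixes G :: "('a, 'b) pre_digraph" and m \<delta> :: nat
  assumes "Digraph.graph G"
    and "Digraph_Component.connected G"
    and "m = card (uedges G)" and "m > 0"
    and "\<delta> = min_degree G"
  shows "real \<delta> * sqrt 2 * (real m)\<^sup>2 / real (first_Zagreb G) \<le> DSO G
    \<and> DSO G \<le> real m * sqrt ((real (first_Zagreb G) - real m) / real (first_Zagreb G))
    \<and> (DSO G = real \<delta> * sqrt 2 * (real m)\<^sup>2 / real (first_Zagreb G) \<longleftrightarrow> regular_graph G)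
    \<and> (DSO G = real m * sqrt ((real (first_Zagreb G) - real m) / real (first_Zagreb G))
        \<longleftrightarrow> digraph_iso G K2)"
proof -
  interpret Digraph.graph G by fact
  show ?thesis
    using DSO_lower_bound DSO_upper_bound digraph_iso_K2_iff[OF assms(2)] assms(4)
    unfolding assms(3,5) by blast
qed

end
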